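(* Let $f$ be a unimodal map whose kneading map $Q$ satisfies $Q(k)\le 1$ for every $k\ge 1$. Then the following statements are equivalent: (1) The binary word $Q(1)Q(2)Q(3)\cdots$ is Sturmian. (2) There exists a unique irrational number $\omega\in(0,1)$ such that for every $k\ge1$ $$Q(k)=\lfloor k\omega\rfloor-\lfloor (k-1)\omega\rfloor .$$ In this case, $Q(1)Q(2)Q(3)\cdots$ is the lower mechanical word of slope $\omega$, and the cutting times of $f$ satisfy $$S_k=1+k+\lfloor k\omega\rfloor=1+\lfloor k(1+\omega)\rfloor$$ for every $k\ge 0$.
   Context: $\mathbb N$ is the set of positive integers and $\mathbb N_0=\mathbb N\cup\{0\}$. $[a,b]$ denotes the closed interval with endpoints $a,b$, in whichever order. Unimodal map: a continuous noninjective map $f:I\to I$ of a compact interval $I$ with $f(\partial I)\subset\partial I$, having a unique turning point $c\in\mathrm{int}(I)$, which is a maximum: $f$ is strictly increasing to the left of $c$ and strictly decreasing to the right of $c$. Write $c_n=f^n(c)$. Standing normalization: $c_2<c<c_1$ and $c_2<c_3$. Cutting times and kneading map: let $D_1=[c,c_1]$ and, for $n\ge2$, $D_n=f(D_{n-1})$ if $c\notin D_{n-1}$, and $D_n=[c_n,c_1]$ if $c\in D_{n-1}$. An integer $n\ge1$ is a cutting time if $c\in D_n$. The cutting times are enumerated increasingly as $1=S_0<S_1=2<S_2<\cdots$ (it is part of the setting that there are infinitely many). The difference of two consecutive cutting times is again a cutting time, and the kneading map $Q:\mathbb N\to\mathbb N_0$ is defined by $S_k-S_{k-1}=S_{Q(k)}$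 for $k\ge1$. An infinite binary word $u=u_1u_2\cdots\in\{0,1\}^{\mathbb N}$ is Sturmian if for every $n\ge1$ it has exactly $n+1$ distinct subwords (blocks of consecutive letters) of length $n$. The lower mechanical word of irrational slope $\omega\in(0,1)$ is the word whose $k$-th letter is $\lfloor k\omega\rfloor-\lfloor(k-1)\omega\rfloor$, $k\ge1$. *)

theory Defs
  imports "HOL-Analysis.Analysis"
begin

text \<open>Uniqueness of the turning point \<open>c\<close> is forced by the two monotonicity clauses.\<close>

definition unimodal_map :: "real \<Rightarrow> real \<Rightarrow> (real \<Rightarrow> real) \<Rightarrow> real \<Rightarrow> bool" where
  "unimodal_map a b f c \<longleftrightarrow>
     a < b \<and>
     continuous_on {a..b} f \<and> f ` {a..b} \<subseteq> {a..b} \<and> \<not> inj_on f {a..b} \<and>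
     f ` {a, b} \<subseteq> {a, b} \<and>
     c \<in> {a<..<b} \<and> strict_mono_on {a..c} f \<and> strict_antimono_on {c..b} f"

text \<open>The intervals \<open>D\<^sub>n\<close>, \<open>n \<ge> 1\<close>; the value at \<open>0\<close> is a dummy.
  On the reals \<^const>\<open>closed_segment\<close> is the closed interval whose endpoints are given in
  whichever order.\<close>

fun cutting_interval :: "(real \<Rightarrow> real) \<Rightarrow> real \<Rightarrow> nat \<Rightarrow> real set" where
  "cutting_interval f c 0 = {}"
| "cutting_interval f c (Suc 0) = closed_segment c (f c)"
| "cutting_interval f c (Suc (Suc n)) =
     (if c \<in> cutting_interval f c (Suc n)
      then closed_segment ((f ^^ Suc (Suc n)) c) (f c)
      else f ` cutting_interval f c (Suc n))"

definition cutting_times :: "(real \<Rightarrow> real) \<Rightarrow> real \<Rightarrow> nat set" where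
  "cutting_times f c = {n. n \<ge> 1 \<and> c \<in> cutting_interval f c n}"

definition cutting_time :: "(real \<Rightarrow> real) \<Rightarrow> real \<Rightarrow> nat \<Rightarrow> nat" where
  "cutting_time f c k = enumerate (cutting_times f c) k"

text \<open>Meaningful for \<open>k \<ge> 1\<close> only.\<close>

definition kneading_map :: "(real \<Rightarrow> real) \<Rightarrow> real \<Rightarrow> nat \<Rightarrow> nat" where
  "kneading_map f c k =
     (THE j. cutting_time f c k - cutting_time f c (k - 1) = cutting_time f c j)"

text \<open>An infinite word \<open>u\<^sub>1 u\<^sub>2 \<dots>\<close> is a function on \<^typ>\<open>nat\<close> of which only the values at
  positive arguments matter.\<close>

definition subwords :: "(nat \<Rightarrow> 'a) \<Rightarrow> nat \<Rightarrow> 'a list set" where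
  "subwords u n = {map u [i..<i + n] | i. i \<ge> 1}"

definition sturmian :: "(nat \<Rightarrow> nat) \<Rightarrow> bool" where
  "sturmian u \<longleftrightarrow> (\<forall>k\<ge>1. u k \<in> {0, 1}) \<and> (\<forall>n\<ge>1. card (subwords u n) = n + 1)"

definition lower_mechanical_word :: "real \<Rightarrow> nat \<Rightarrow> int" where
  "lower_mechanical_word \<omega> k = \<lfloor>real k * \<omega>\<rfloor> - \<lfloor>(real k - 1) * \<omega>\<rfloor>"

end

theory Submission
  imports Defs
begin

text \<open>If \<open>Q \<le> 1\<close>, consecutive cutting times differ by \<open>S\<^sub>0 = 1\<close> or \<open>S\<^sub>1 = 2\<close>. Reading the orbit of
  \<open>c\<close> from \<open>c\<^sub>2\<close> on, the letter \<open>0\<close> is one step on the increasing branch and \<open>1\<close> is two steps on the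
  decreasing branch, so the order of points agrees with the lexicographic order of their words.
  Since \<open>c\<^sub>2\<close> is the minimum of the orbit, the word \<open>Q\<close> is lexicographically minimal among its shifts.

  A Sturmian word is balanced. For a balanced and lexicographically minimal word, no factor has
  fewer letters \<open>1\<close> than the prefix of the same length, so the prefix weights \<open>h\<close> satisfy
  \<open>h m + h n \<le> h (m + n) \<le> h m + h n + 1\<close>. Hence \<open>h n \<le> n\<omega> \<le> h n + 1\<close> for
  \<open>\<omega> = sup h n / n\<close>. A rational \<open>\<omega>\<close> would make the word eventually periodic, so
  \<open>h n = \<lfloor>n\<omega>\<rfloor>\<close>.\<close>

section \<open>Sturmian words\<close>

definition factor :: "(nat \<Rightarrow> 'a) \<Rightarrow> nat \<Rightarrow> nat \<Rightarrow> 'a list" where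
  "factor u i n = map u [i..<i + n]"

definition right_special :: "(nat \<Rightarrow> nat) \<Rightarrow> nat \<Rightarrow> nat list set" where
  "right_special u n = {x. x @ [0] \<in> subwords u (Suc n) \<and> x @ [1] \<in> subwords u (Suc n)}"

definition binary_word :: "(nat \<Rightarrow> nat) \<Rightarrow> bool" where
  "binary_word u \<longleftrightarrow> (\<forall>k\<ge>1. u k \<in> {0, 1})"

definition eventually_periodic :: "(nat \<Rightarrow> 'a) \<Rightarrow> bool" where
  "eventually_periodic u \<longleftrightarrow> (\<exists>N\<ge>1. \<exists>p>0. \<forall>k\<ge>N. u (k + p) = u k)"

definition weight :: "(nat \<Rightarrow> nat) \<Rightarrow> nat \<Rightarrow> nat \<Rightarrow> nat" where
  "weight u i n = (\<Sum>t<n. u (i + t))"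

definition balanced_word :: "(nat \<Rightarrow> nat) \<Rightarrow> bool" where
  "balanced_word u \<longleftrightarrow> (\<forall>n. \<forall>i\<ge>1. \<forall>k\<ge>1. weight u i n \<le> weight u k n + 1)"

lemma factor_0 [simp]: "factor u i 0 = []"
  by (simp add: factor_def)

lemma factor_eq_iff: "factor u i n = factor u k n \<longleftrightarrow> (\<forall>j<n. u (i + j) = u (k + j))"
  by (auto simp: factor_def list_eq_iff_nth_eq)

lemma factor_Suc: "factor u i (Suc n) = factor u i n @ [u (i + n)]"
  by (simp add: factor_def)

lemma factor_Suc_Cons: "factor u i (Suc n) = u i # factor u (Suc i) n"
  by (simp add: factor_def upt_conv_Cons del: upt_Suc)

lemma subwords_eq: "subwords u n = (\<lambda>i. factor u i n) ` {1..}"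
  by (auto simp: subwords_def factor_def)

lemma factor_in_subwords [intro]: "i \<ge> 1 \<Longrightarrow> factor u i n \<in> subwords u n"
  by (auto simp: subwords_eq)

lemma binaryD: "binary_word u \<Longrightarrow> k \<ge> 1 \<Longrightarrow> u k = 0 \<or> u k = 1"
  by (auto simp: binary_word_def)

lemma finite_subwords:
  assumes "binary_word u" shows "finite (subwords u n)"
proof (rule finite_subset)
  show "subwords u n \<subseteq> {xs. set xs \<subseteq> {0, 1} \<and> length xs = n}"
  proof
    fix xs assume "xs \<in> subwords u n"
    then obtain i where "i \<ge> 1" "xs = map u [i..<i + n]" by (auto simp: subwords_def)
    then show "xs \<in> {xs. set xs \<subseteq> {0, 1} \<and> length xs = n}"
      using assms unfolding binary_word_def by (simp add: image_subset_iff)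
  qed
qed (simp add: finite_lists_length_eq)

lemma card_subwords_0 [simp]: "card (subwords u 0) = 1"
proof -
  have "subwords u 0 = {[]}" by (auto simp: subwords_eq)
  then show ?thesis by simp
qed

text \<open>Each factor of length \<open>n\<close> can be continued by at least one letter, and by
  both exactly when it is right special; these are the ones counted twice.\<close>

lemma card_subwords_Suc:
  assumes u: "binary_word u"
  shows "card (subwords u (Suc n)) = card (subwords u n) + card (right_special u n)"
proof -
  define A where "A d = {x. x @ [d] \<in> subwords u (Suc n)}" for d
  have A_sub: "A d \<subseteq> subwords u n" for d
    by (auto simp: A_def subwords_eq factor_Suc)
  have fin: "finite (A d)" for d
    using A_sub finite_subwords[OF u] finite_subset by blast
  have un: "A 0 \<union> A 1 = subwords u n"
  proof
    show "subwords u n \<subseteq> A 0 \<union> A 1"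
    proof
      fix x assume "x \<in> subwords u n"
      then obtain i where i: "i \<ge> 1" "x = factor u i n" by (auto simp: subwords_eq)
      have "x @ [u (i + n)] \<in> subwords u (Suc n)"
        using i by (auto simp: subwords_eq factor_Suc)
      moreover have "u (i + n) = 0 \<or> u (i + n) = 1" using binaryD[OF u] i by simp
      ultimately show "x \<in> A 0 \<union> A 1" by (auto simp: A_def)
    qed
  qed (use A_sub in blast)
  have "subwords u (Suc n) = (\<lambda>x. x @ [0]) ` A 0 \<union> (\<lambda>x. x @ [1]) ` A 1"
  proof
    show "subwords u (Suc n) \<subseteq> (\<lambda>x. x @ [0]) ` A 0 \<union> (\<lambda>x. x @ [1]) ` A 1"
    proof
      fix y assume y: "y \<in> subwords u (Suc n)"
      then obtain i where i: "i \<ge> 1" "y = factor u i n @ [u (i + n)]"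
        by (auto simp: subwords_eq factor_Suc)
      moreover have "u (i + n) = 0 \<or> u (i + n) = 1" using binaryD[OF u] i by simp
      ultimately show "y \<in> (\<lambda>x. x @ [0]) ` A 0 \<union> (\<lambda>x. x @ [1]) ` A 1"
        using y by (auto simp: A_def)
    qed
  qed (auto simp: A_def)
  then have "card (subwords u (Suc n))
      = card ((\<lambda>x. x @ [0]) ` A 0) + card ((\<lambda>x. x @ [1]) ` A 1)"
    using fin by (auto intro!: card_Un_disjoint)
  also have "\<dots> = card (A 0) + card (A 1)"
    by (simp add: card_image inj_on_def)
  also have "\<dots> = card (A 0 \<union> A 1) + card (A 0 \<inter> A 1)"
    using fin card_Un_Int by blast
  also have "A 0 \<inter> A 1 = right_special u n"
    by (auto simp: A_def right_special_def)
  finally show ?thesis unfolding un .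
qed

text \<open>A factor that is not right special determines the letter that follows it, so a repetition
  without right special factors in between repeats forever.\<close>

lemma eventually_periodic_if_repetition:
  assumes u: "binary_word u" and rs: "1 \<le> r" "r < s"
    and eq: "factor u r n = factor u s n"
    and not_special: "\<And>t. t \<in> {r..<s} \<Longrightarrow> factor u t n \<notin> right_special u n"
  shows "eventually_periodic u"
proof -
  have next_eq: "u (i + n) = u (k + n)"
    if "factor u i n = factor u k n" "factor u i n \<notin> right_special u n" "i \<ge> 1" "k \<ge> 1" for i k
  proof (rule ccontr)
    assume ne: "u (i + n) \<noteq> u (k + n)"
    have "factor u i n @ [u (i + n)] \<in> subwords u (Suc n)"
      "factor u i n @ [u (k + n)] \<in> subwords u (Suc n)"
      using that factor_in_subwords[of i u "Suc n"] factor_in_subwords[of k u "Suc n"]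
      by (simp_all add: factor_Suc)
    with ne that binaryD[OF u, of "i + n"] binaryD[OF u, of "k + n"] show False
      by (auto simp: right_special_def)
  qed
  have main: "factor u (r + t) n = factor u (s + t) n \<and> factor u (r + t) n \<notin> right_special u n" for t
  proof (induction t rule: less_induct)
    case (less t)
    have "factor u (r + t) n = factor u (s + t) n"
    proof (cases t)
      case (Suc t')
      have IH: "factor u (r + t') n = factor u (s + t') n" "factor u (r + t') n \<notin> right_special u n"
        using less.IH[of t'] Suc by auto
      have "u (r + t' + n) = u (s + t' + n)"
        using next_eq[OF IH] rs by simp
      with IH have "factor u (r + t') (Suc n) = factor u (s + t') (Suc n)"
        by (simp add: factor_Suc)
      then show ?thesis by (simp add: factor_Suc_Cons Suc)
    qed (use eq in simp)
    moreover have "factor u (r + t) n \<notin> right_special u n"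
    proof (cases "r + t < s")
      case True
      then show ?thesis using not_special[of "r + t"] by simp
    next
      case False
      \<comment> \<open>Here \<open>r + t = s + t'\<close>, and by induction the factor there equals
        the one at \<open>r + t'\<close>, which is not special.\<close>
      define t' where "t' = r + t - s"
      have t': "t' < t" "r + t = s + t'" using False rs by (auto simp: t'_def)
      then show ?thesis using less.IH[of t'] by metis
    qed
    ultimately show ?case by simp
  qed
  have "u (k + (s - r)) = u k" if k: "k \<ge> r + n" for k
  proof -
    obtain t where t: "k = r + t + n" using k by (metis add.assoc add.commute le_Suc_ex)
    then show ?thesis
      using next_eq[OF conjunct1[OF main] conjunct2[OF main], of t] rs by (simp add: algebra_simps)
  qed
  moreover have "1 \<le> r + n" "s - r > 0" using rs by auto
  ultimately show ?thesis unfolding eventually_periodic_def by blast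
qed

text \<open>Shifting back by the period brings every factor to a position below
  \<open>N + p\<close>, so the number of factors is bounded independently of their length.\<close>

lemma not_eventually_periodic_if_sturmian:
  assumes "sturmian u" shows "\<not> eventually_periodic u"
proof
  assume "eventually_periodic u"
  then obtain N p where N: "N \<ge> 1" "p > 0" and per: "\<And>k. k \<ge> N \<Longrightarrow> u (k + p) = u k"
    by (auto simp: eventually_periodic_def)
  \<comment> \<open>This length is large enough: \<open>n + 1\<close> factors exceed the
    \<open>N + p - 1\<close> available positions.\<close>
  define n where "n = N + p"
  have "factor u i n \<in> (\<lambda>i. factor u i n) ` {1..<N + p}" if "i \<ge> 1" for i
    using that
  proof (induction i rule: less_induct)
    case (less i)
    show ?case
    proof (cases "i < N + p")
      case False
      have "u (i - p + j) = u (i + j)" for j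
        using per[of "i - p + j"] False by simp
      then have "factor u i n = factor u (i - p) n"
        by (simp add: factor_eq_iff)
      moreover have "factor u (i - p) n \<in> (\<lambda>i. factor u i n) ` {1..<N + p}"
        using less False N by simp
      ultimately show ?thesis by simp
    qed (use less in auto)
  qed
  then have "subwords u n \<subseteq> (\<lambda>i. factor u i n) ` {1..<N + p}"
    by (auto simp: subwords_eq)
  then have "card (subwords u n) \<le> card {1..<N + p}"
    by (rule surj_card_le[rotated]) simp
  moreover have "card (subwords u n) = n + 1"
    using assms N by (simp add: sturmian_def n_def)
  ultimately show False by (simp add: n_def)
qed

section \<open>Weights of factors and balance\<close>

lemma weight_add: "weight u i (m + n) = weight u i m + weight u (i + m) n"
  by (induction n) (auto simp: weight_def algebra_simps)

lemma weight_0 [simp]: "weight u i 0 = 0"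
  by (simp add: weight_def)

lemma weight_Suc: "weight u i (Suc n) = weight u i n + u (i + n)"
  by (simp add: weight_def)

lemma weight_Suc_Cons: "weight u i (Suc n) = u i + weight u (Suc i) n"
  using weight_add[of u i 1 n] by (simp add: weight_Suc)

lemma weight_cong: "(\<And>j. j < n \<Longrightarrow> u (i + j) = u (k + j)) \<Longrightarrow> weight u i n = weight u k n"
  unfolding weight_def by (rule sum.cong) auto

text \<open>Reversal keeps the weight; this compares prefixes and suffixes of the palindrome
  below.\<close>

lemma weight_reflect:
  "(\<And>j. j < n \<Longrightarrow> u (i + j) = u (k + (n - Suc j))) \<Longrightarrow> weight u i n = weight u k n"
  unfolding weight_def by (subst (2) sum.nat_diff_reindex[symmetric]) (rule sum.cong, auto)

lemma weight_le: "binary_word u \<Longrightarrow> i \<ge> 1 \<Longrightarrow> weight u i n \<le> n"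
proof (induction n)
  case (Suc n)
  then show ?case using binaryD[of u "i + n"] by (auto simp: weight_Suc)
qed simp

text \<open>In a shortest pair of factors whose weights differ by \<open>2\<close>, minimality applied to
  prefixes and suffixes forces the shape \<open>0w0\<close>, \<open>1w1\<close>. If \<open>w\<close> were no palindrome, the shortest
  prefix violating the symmetry and its mirror suffix would give a shorter pair.\<close>

lemma unbalanced_palindrome:
  assumes u: "binary_word u" and unb: "\<not> balanced_word u"
  obtains i k m where "i \<ge> 1" "k \<ge> 1" "u i = 0" "u k = 1" "u (i + Suc m) = 0" "u (k + Suc m) = 1"
    "\<And>j. 1 \<le> j \<Longrightarrow> j \<le> m \<Longrightarrow> u (k + j) = u (i + j)"
    "\<And>j. 1 \<le> j \<Longrightarrow> j \<le> m \<Longrightarrow> u (i + (Suc m - j)) = u (i + j)"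
proof -
  define P where "P n \<longleftrightarrow> (\<exists>i\<ge>1. \<exists>k\<ge>1. weight u k n \<ge> weight u i n + 2)" for n
  define n where "n = (LEAST n. P n)"
  have "\<exists>n i k. i \<ge> 1 \<and> k \<ge> 1 \<and> weight u k n + 1 < weight u i n"
    using unb unfolding balanced_word_def not_le[symmetric] by blast
  then have "\<exists>n. P n" unfolding P_def by (metis Suc_1 Suc_leI add_Suc_right Suc_eq_plus1)
  then have "P n" unfolding n_def by (rule LeastI_ex)
  then obtain i k where ik: "i \<ge> 1" "k \<ge> 1" and big: "weight u k n \<ge> weight u i n + 2"
    by (auto simp: P_def)
  have min: "weight u k' j \<le> weight u i' j + 1" if "j < n" "i' \<ge> 1" "k' \<ge> 1" for j i' k'
  proof -
    have "\<not> P j" using not_less_Least[of j P] that(1) by (simp add: n_def)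
    then show ?thesis using that(2,3) by (fastforce simp: P_def)
  qed
  have "n \<ge> 2" using weight_le[OF u ik(2), of n] big by simp
  then obtain m where n: "n = Suc (Suc m)" by (metis add_2_eq_Suc le_Suc_ex)
  \<comment> \<open>A prefix and the complementary suffix each contribute at most 1 to a difference
    of at least 2, so each contributes exactly 1.\<close>
  have diff1: "weight u k j = weight u i j + 1" if "1 \<le> j" "j < n" for j
  proof -
    have "weight u k j \<le> weight u i j + 1" using min that ik by simp
    moreover have "weight u (k + j) (n - j) \<le> weight u (i + j) (n - j) + 1"
      using min[of "n - j" "i + j" "k + j"] that ik by simp
    moreover have "weight u k n = weight u k j + weight u (k + j) (n - j)"
      "weight u i n = weight u i j + weight u (i + j) (n - j)"
      using weight_add[of u _ j "n - j"] that by simp_all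
    ultimately show ?thesis using big by simp
  qed
  have first: "u i = 0" "u k = 1"
    using diff1[of 1] n binaryD[OF u ik(2)] by (auto simp: weight_Suc)
  have same: "u (k + j) = u (i + j)" if "1 \<le> j" "j \<le> m" for j
    using diff1[of j] diff1[of "Suc j"] that n by (simp add: weight_Suc)
  have last: "u (i + Suc m) = 0" "u (k + Suc m) = 1"
    using diff1[of "Suc m"] big n binaryD[OF u, of "k + Suc m"] ik
    by (auto simp: weight_Suc[of _ _ "Suc m"])
  have "u (i + (Suc m - j)) = u (i + j)" if "1 \<le> j" "j \<le> m" for j
    using that
  proof (induction j rule: less_induct)
    case (less j)
    obtain l where l: "j = Suc l" using less.prems by (cases j) auto
    \<comment> \<open>The first and the last \<open>l\<close> letters of the middle word are mirror
      images by induction, and \<open>same\<close> allows reading them at \<open>i\<close> or at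
      \<open>k\<close>.\<close>
    have wl: "weight u (Suc p) l = weight u (q + (Suc m - l)) l"
      if "p \<in> {i, k}" "q \<in> {i, k}" for p q
    proof (rule weight_reflect)
      fix t assume t: "t < l"
      have "u (Suc p + t) = u (i + Suc t)"
        using same[of "Suc t"] that t l less.prems by auto
      also have "\<dots> = u (i + (Suc m - Suc t))"
        using less.IH[of "Suc t"] t l less.prems by simp
      also have "\<dots> = u (q + (Suc m - Suc t))"
        using same[of "Suc m - Suc t"] that t l less.prems by auto
      also have "Suc m - Suc t = Suc m - l + (l - Suc t)"
        using t l less.prems by simp
      finally show "u (Suc p + t) = u (q + (Suc m - l) + (l - Suc t))"
        by (simp add: add.assoc)
    qed
    have pre: "weight u p (Suc j) = u p + weight u (Suc p) l + u (p + j)" for p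
      by (simp add: weight_Suc[of u p j]) (simp add: l weight_Suc_Cons)
    have suf: "weight u (p + (Suc m - j)) (Suc j)
        = u (p + (Suc m - j)) + weight u (p + (Suc m - l)) l + u (p + Suc m)" for p
    proof -
      have "weight u (p + (Suc m - j)) (Suc j)
        = u (p + (Suc m - j)) + weight u (Suc (p + (Suc m - j))) (Suc l)"
        by (simp add: l weight_Suc_Cons)
      also have "Suc (p + (Suc m - j)) = p + (Suc m - l)" using l less.prems by simp
      also have "weight u (p + (Suc m - l)) (Suc l)
          = weight u (p + (Suc m - l)) l + u (p + (Suc m - l) + l)"
        by (simp add: weight_Suc)
      also have "p + (Suc m - l) + l = p + Suc m" using l less.prems by simp
      finally show ?thesis by simp
    qed
    have sameJ: "u (k + j) = u (i + j)" "u (k + (Suc m - j)) = u (i + (Suc m - j))"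
      using same[of j] same[of "Suc m - j"] less.prems by auto
    have bin: "u (i + j) = 0 \<or> u (i + j) = 1" "u (i + (Suc m - j)) = 0 \<or> u (i + (Suc m - j)) = 1"
      using binaryD[OF u] ik by simp_all
    have jn: "Suc j < n" using less.prems n by simp
    \<comment> \<open>\<open>A\<close> compares a suffix of \<open>1w1\<close> with a prefix of
      \<open>0w0\<close>, \<open>B\<close> a prefix of \<open>1w1\<close> with a suffix of
      \<open>0w0\<close>. After the mirrored weights cancel, they are the two inequalities between
      \<open>u (i + j)\<close> and its mirror letter.\<close>
    have A: "weight u (k + (Suc m - j)) (Suc j) \<le> weight u i (Suc j) + 1"
      by (rule min[OF jn]) (use ik in auto)
    have B: "weight u k (Suc j) \<le> weight u (i + (Suc m - j)) (Suc j) + 1"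
      by (rule min[OF jn]) (use ik in auto)
    show ?case
      using A B first last bin sameJ wl[of i k] wl[of k i]
      unfolding pre[of i] pre[of k] suf[of i] suf[of k] by auto
  qed
  with first same last ik show ?thesis using that by blast
qed

text \<open>Exactly one factor of each length is right special. With \<open>0w0\<close>, \<open>1w1\<close> factors and \<open>w\<close> a
  palindrome, the right special factor \<open>R\<close> of length \<open>|w| + 1\<close> is \<open>0w\<close> or \<open>1w\<close>. The other one,
  at position \<open>q\<close>, is followed by \<open>|w| + 1\<close> further positions without \<open>R\<close>, by symmetry of \<open>w\<close>, so
  a factor repeats there by the pigeonhole principle.\<close>

lemma balanced_if_sturmian:
  assumes st: "sturmian u"
  shows "balanced_word u"
proof (rule ccontr)
  have u: "binary_word u" using st by (simp add: sturmian_def binary_word_def)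
  have cardn: "card (subwords u n) = n + 1" for n
    using st by (cases n) (auto simp: sturmian_def)
  then have card_rs: "card (right_special u n) = 1" for n
    using card_subwords_Suc[OF u, of n] by simp
  assume "\<not> balanced_word u"
  then obtain i k m where ik: "i \<ge> 1" "k \<ge> 1"
    and i: "u i = 0" "u (i + Suc m) = 0" and k: "u k = 1" "u (k + Suc m) = 1"
    and same: "\<And>j. 1 \<le> j \<Longrightarrow> j \<le> m \<Longrightarrow> u (k + j) = u (i + j)"
    and pal: "\<And>j. 1 \<le> j \<Longrightarrow> j \<le> m \<Longrightarrow> u (i + (Suc m - j)) = u (i + j)"
    using unbalanced_palindrome[OF u] by metis
  define w where "w = factor u (Suc i) m"
  have w_k: "w = factor u (Suc k) m"
    unfolding w_def factor_eq_iff using same by (metis Suc_leI add.commute add_Suc_right le_add1 plus_1_eq_Suc)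
  have w_special: "w \<in> right_special u m"
  proof -
    have "factor u (Suc i) (Suc m) = w @ [0]" "factor u (Suc k) (Suc m) = w @ [1]"
      using i k by (simp_all add: w_def w_k[unfolded w_def] factor_Suc)
    then show ?thesis
      unfolding right_special_def using factor_in_subwords[of "Suc i" u "Suc m"] factor_in_subwords[of "Suc k" u "Suc m"]
      by simp
  qed
  obtain R where R: "right_special u (Suc m) = {R}"
    using card_rs card_1_singletonE by blast
  have tl_shift: "tl y \<in> subwords u n" if "y \<in> subwords u (Suc n)" for y n
    using that by (fastforce simp: subwords_eq factor_Suc_Cons)
  have R_in: "R @ [0] \<in> subwords u (Suc (Suc m))" "R @ [1] \<in> subwords u (Suc (Suc m))"
    using R by (auto simp: right_special_def)
  then have R_sub: "R \<in> subwords u (Suc m)" by (auto simp: subwords_eq factor_Suc)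
  then have "R \<noteq> []" by (auto simp: subwords_eq factor_Suc)
  \<comment> \<open>A right special factor stays right special without its first letter, and
    \<open>w\<close> is the only one of its length.\<close>
  have "tl R \<in> right_special u m"
    using tl_shift[OF R_in(1)] tl_shift[OF R_in(2)] \<open>R \<noteq> []\<close> by (simp add: right_special_def)
  then have tl_R: "tl R = w"
    using w_special card_rs[of m] by (metis card_1_singletonE singletonD)
  have "hd R \<in> {0, 1}"
    using R_sub binaryD[OF u] by (fastforce simp: subwords_eq factor_Suc_Cons)
  \<comment> \<open>\<open>q\<close> starts the one of \<open>0w0\<close>, \<open>1w1\<close> whose
    outer letter differs from the first letter of \<open>R\<close>.\<close>
  then obtain q where q: "q \<in> {i, k}" "u q \<noteq> hd R"
    using i(1) k(1) by (metis insertCI zero_neq_one)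
  have qlast: "u (q + Suc m) = u q" using q i k by auto
  have uq: "u (q + j) = u (i + j)" if "1 \<le> j" "j \<le> m" for j using q same that by auto
  have avoid: "factor u (q + t) (Suc m) \<noteq> R" if "t \<le> Suc m" for t
  proof
    assume eq: "factor u (q + t) (Suc m) = R"
    then have hdR: "u (q + t) = hd R" by (auto simp: factor_Suc_Cons)
    have "t \<noteq> 0" "t \<noteq> Suc m" using hdR q qlast by (metis add_0_right, metis)
    with that have t: "1 \<le> t" "t \<le> m" by auto
    \<comment> \<open>An occurrence of \<open>R\<close> at \<open>q + t\<close> covers position
      \<open>q + Suc m\<close>. By the symmetry of \<open>w\<close>, the outer letter there would
      equal \<open>u (i + t)\<close>, which is \<open>hd R\<close>.\<close>
    have "\<forall>j<m. u (Suc (q + t) + j) = u (Suc i + j)"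
      unfolding factor_eq_iff[symmetric] using eq tl_R by (auto simp: factor_Suc_Cons w_def)
    then have "u (Suc (q + t) + (m - t)) = u (Suc i + (m - t))"
      using t by (elim allE[of _ "m - t"]) auto
    moreover have "Suc (q + t) + (m - t) = q + Suc m" "Suc i + (m - t) = i + (Suc m - t)"
      using t by auto
    ultimately have "u q = u (i + t)" using pal[OF t] qlast by metis
    with uq[OF t] hdR q show False by simp
  qed
  \<comment> \<open>The \<open>m + 2\<close> positions carry factors different from
    \<open>R\<close>, and only \<open>m + 1\<close> of these exist.\<close>
  have "\<not> inj_on (\<lambda>t. factor u (q + t) (Suc m)) {..Suc m}"
  proof (rule pigeonhole)
    have "(\<lambda>t. factor u (q + t) (Suc m)) ` {..Suc m} \<subseteq> subwords u (Suc m) - {R}"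
      using avoid ik q by fastforce
    then have "card ((\<lambda>t. factor u (q + t) (Suc m)) ` {..Suc m}) \<le> card (subwords u (Suc m) - {R})"
      by (intro card_mono) (auto simp: finite_subwords[OF u])
    also have "\<dots> = Suc m" using cardn R_sub finite_subwords[OF u] by simp
    finally show "card ((\<lambda>t. factor u (q + t) (Suc m)) ` {..Suc m}) < card {..Suc m}" by simp
  qed
  then obtain t1 t2 where t: "t1 < t2" "t2 \<le> Suc m"
    "factor u (q + t1) (Suc m) = factor u (q + t2) (Suc m)"
    by (auto simp: inj_on_def) (metis linorder_neqE_nat)+
  have "eventually_periodic u"
  proof (rule eventually_periodic_if_repetition[OF u])
    show "factor u (q + t1) (Suc m) = factor u (q + t2) (Suc m)" by (rule t)
    show "factor u t (Suc m) \<notin> right_special u (Suc m)" if "t \<in> {q + t1..<q + t2}" for t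
    proof -
      have "t - q \<le> Suc m" "q + (t - q) = t" using that t(2) by auto
      then show ?thesis using avoid[of "t - q"] R by simp
    qed
    show "1 \<le> q + t1" using ik q by auto
    show "q + t1 < q + t2" using t(1) by simp
  qed
  with not_eventually_periodic_if_sturmian[OF st] show False by simp
qed

section \<open>The slope of a balanced, lexicographically minimal word\<close>

definition lex_minimal :: "(nat \<Rightarrow> nat) \<Rightarrow> bool" where
  "lex_minimal u \<longleftrightarrow>
     (\<forall>k j. (\<forall>i\<in>{1..j}. u (k + i) = u i) \<longrightarrow> u (Suc j) \<le> u (k + Suc j))"

text \<open>At the first difference, minimality puts the smaller letter into the prefix; by balance
  the remaining letters can win back at most 1.\<close>

lemma prefix_weight_le:
  assumes u: "binary_word u" "balanced_word u" "lex_minimal u"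
  shows "weight u 1 n \<le> weight u (Suc k) n"
proof (rule ccontr)
  assume less: "\<not> ?thesis"
  define t where "t = (LEAST t. u (Suc k + t) \<noteq> u (1 + t))"
  have "\<exists>t<n. u (Suc k + t) \<noteq> u (1 + t)"
    using less weight_cong[of n u "Suc k" 1] by fastforce
  then obtain t' where t': "t' < n" "u (Suc k + t') \<noteq> u (1 + t')" by blast
  have t: "u (Suc k + t) \<noteq> u (1 + t)"
    unfolding t_def by (rule LeastI) (rule t'(2))
  have tn: "t < n"
    using Least_le[of "\<lambda>t. u (Suc k + t) \<noteq> u (1 + t)", OF t'(2)] t'(1) unfolding t_def by simp
  have eq: "u (Suc k + j) = u (1 + j)" if "j < t" for j
    using not_less_Least[of j "\<lambda>t. u (Suc k + t) \<noteq> u (1 + t)"] that unfolding t_def by blast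
  have "u (k + i) = u i" if "i \<in> {1..t}" for i
    using eq[of "i - 1"] that by (cases i) auto
  then have "u (Suc t) \<le> u (k + Suc t)" using u(3) by (simp add: lex_minimal_def)
  with t have lt: "u (Suc t) < u (Suc k + t)" by simp
  obtain r where r: "n = t + Suc r" using tn less_imp_Suc_add by auto
  have split: "weight u i n = weight u i t + u (i + t) + weight u (Suc (i + t)) r" for i
    unfolding r weight_add weight_Suc_Cons[of u "i + t"] by simp
  have "weight u (Suc k) t = weight u 1 t" using eq by (intro weight_cong) simp
  moreover have "weight u (Suc (1 + t)) r \<le> weight u (Suc (Suc k + t)) r + 1"
    using u(2) unfolding balanced_word_def by simp
  ultimately show False using less lt unfolding split[of 1] split[of "Suc k"] by simp
qed

lemma lower_mechanical_if_sturmian: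
  assumes st: "sturmian u" and lex: "lex_minimal u"
  shows "\<exists>\<omega>::real. \<omega> \<notin> \<rat> \<and> \<omega> \<in> {0<..<1} \<and>
    (\<forall>k\<ge>1. int (u k) = \<lfloor>real k * \<omega>\<rfloor> - \<lfloor>(real k - 1) * \<omega>\<rfloor>)"
proof -
  have u: "binary_word u" using st by (simp add: sturmian_def binary_word_def)
  have bal: "balanced_word u" using st by (rule balanced_if_sturmian)
  define h where "h n = weight u 1 n" for n
  have sup: "h m + h n \<le> h (m + n)" for m n
    using prefix_weight_le[OF u bal lex, of n m] by (simp add: h_def weight_add)
  have sub: "h (m + n) \<le> h m + h n + 1" for m n
    using bal by (simp add: h_def weight_add balanced_word_def)
  have mult_lower: "k * h n \<le> h (k * n)" for k n
  proof (induction k)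
    case (Suc k)
    then show ?case using sup[of n "k * n"] by simp
  qed simp
  \<comment> \<open>By \<open>sub\<close>, the function \<open>h + 1\<close> is subadditive.\<close>
  have mult_upper: "h (k * n) + 1 \<le> k * (h n + 1)" if "k \<ge> 1" for k n
    using that
  proof (induction k rule: dec_induct)
    case (step k)
    then show ?case using sub[of n "k * n"] by simp
  qed simp
  have cross: "real (h m) / real m \<le> (real (h n) + 1) / real n" if "m \<ge> 1" "n \<ge> 1" for m n
  proof -
    \<comment> \<open>Both sides are compared with \<open>h (m * n)\<close>.\<close>
    have "n * h m \<le> m * (h n + 1)"
      using mult_lower[of n m] mult_upper[OF that(1), of n] by (simp add: mult.commute)
    then have "real n * real (h m) \<le> real m * (real (h n) + 1)"
      by (metis of_nat_1 of_nat_add of_nat_le_iff of_nat_mult)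
    then show ?thesis using that by (simp add: field_simps)
  qed
  \<comment> \<open>By \<open>cross\<close>, every \<open>(h n + 1) / n\<close> bounds all
    \<open>h m / m\<close>, so the supremum separates the two families.\<close>
  define \<omega> where "\<omega> = (SUP m\<in>{1..}. real (h m) / real m)"
  have "bdd_above ((\<lambda>m. real (h m) / real m) ` {1..})"
    by (rule bdd_aboveI2[of _ _ "(real (h 1) + 1) / real 1"]) (use cross in force)
  then have "real (h n) / real n \<le> \<omega>" if "n \<ge> 1" for n
    unfolding \<omega>_def using that by (intro cSUP_upper) auto
  then have lower: "real (h n) \<le> real n * \<omega>" for n
    by (cases "n = 0") (fastforce simp: h_def field_simps)+
  have "\<omega> \<le> (real (h n) + 1) / real n" if "n \<ge> 1" for n
    unfolding \<omega>_def using that cross by (intro cSUP_least) auto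
  then have upper: "real n * \<omega> \<le> real (h n) + 1" for n
    by (cases "n = 0") (fastforce simp: h_def field_simps)+
  have h_Suc: "h (Suc n) = h n + u (Suc n)" for n by (simp add: h_def weight_Suc)
  have irr: "\<omega> \<notin> \<rat>"
  proof
    assume "\<omega> \<in> \<rat>"
    then obtain p q where pq: "q > 0" "\<omega> = of_int p / of_int q"
      using Rats_cases' by metis
    define N where "N = nat q"
    have N: "N > 0" "real N * \<omega> = of_int p" using pq by (auto simp: N_def)
    \<comment> \<open>Equality in either bound passes to multiples. At a common multiple the two
      equalities clash, so the lower and the upper bound are not both attained, even at different
      positive lengths.\<close>
    have zero_mult: "real (k * n) * \<omega> = real (h (k * n))" if "real n * \<omega> = real (h n)" for k n
    proof (rule antisym)
      have "real k * real (h n) \<le> real (h (k * n))"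
        using mult_lower[of k n] by (metis of_nat_le_iff of_nat_mult)
      then show "real (k * n) * \<omega> \<le> real (h (k * n))" using that by (simp add: mult.assoc)
    qed (rule lower)
    have one_mult: "real (k * n) * \<omega> = real (h (k * n)) + 1"
      if "real n * \<omega> = real (h n) + 1" "k \<ge> 1" for k n
    proof (rule antisym)
      have "real (h (k * n)) + 1 \<le> real k * (real (h n) + 1)"
        using mult_upper[OF that(2), of n] by (metis of_nat_1 of_nat_add of_nat_le_iff of_nat_mult)
      then show "real (h (k * n)) + 1 \<le> real (k * n) * \<omega>" using that by (simp add: mult.assoc)
    qed (rule upper)
    have excl: False
      if "real n * \<omega> = real (h n)" "real n' * \<omega> = real (h n') + 1" "n \<ge> 1" "n' \<ge> 1" for n n'
      using zero_mult[OF that(1), of n'] one_mult[OF that(2,3)] by (simp add: mult.commute)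
    \<comment> \<open>As \<open>N * \<omega>\<close> is the integer \<open>p\<close>, any other
      increment makes one bound tight at \<open>n\<close> and the other at
      \<open>n + N\<close>.\<close>
    have step: "int (h (n + N)) = int (h n) + p" if "n \<ge> 1" for n
    proof (rule ccontr)
      assume ne: "int (h (n + N)) \<noteq> int (h n) + p"
      have e: "real (n + N) * \<omega> = real n * \<omega> + of_int p" by (simp add: N(2)[symmetric] algebra_simps)
      consider "int (h (n + N)) \<ge> int (h n) + p + 1" | "int (h (n + N)) \<le> int (h n) + p - 1"
        using ne by linarith
      then show False
      proof cases
        case 1
        then have "real (h (n + N)) \<ge> real (h n) + of_int p + 1"
          by linarith
        then have "real (n + N) * \<omega> = real (h (n + N))" "real n * \<omega> = real (h n) + 1"
          using e lower[of "n + N"] upper[of n] by auto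
        then show False using excl[of "n + N" n] that by simp
      next
        case 2
        then have "real (h (n + N)) \<le> real (h n) + of_int p - 1"
          by linarith
        then have "real (n + N) * \<omega> = real (h (n + N)) + 1" "real n * \<omega> = real (h n)"
          using e lower[of n] upper[of "n + N"] by auto
        then show False using excl[of n "n + N"] that by simp
      qed
    qed
    have "u (k + N) = u k" if k: "k \<ge> 2" for k
    proof -
      obtain n where n: "k = Suc n" "n \<ge> 1" using k by (cases k) auto
      show ?thesis
        using step[of n] step[of "Suc n"] n h_Suc[of n] h_Suc[of "n + N"] by simp
    qed
    then have "eventually_periodic u"
      unfolding eventually_periodic_def using N(1) by (intro exI[of _ 2]) auto
    with not_eventually_periodic_if_sturmian[OF st] show False by simp
  qed
  \<comment> \<open>Irrationality excludes equality in the upper bound.\<close>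
  have floor_h: "\<lfloor>real n * \<omega>\<rfloor> = int (h n)" for n
  proof (cases "n = 0")
    case False
    have "real n * \<omega> \<noteq> real (h n) + 1"
    proof
      assume "real n * \<omega> = real (h n) + 1"
      then have "\<omega> = (real (h n) + 1) / real n" using False by (simp add: field_simps)
      then have "\<omega> \<in> \<rat>" by simp
      with irr show False by simp
    qed
    then have "real n * \<omega> < real (h n) + 1" using upper[of n] by simp
    with lower[of n] show ?thesis by (intro floor_unique) auto
  qed (simp add: h_def)
  have "h 1 \<le> 1" using weight_le[OF u, of 1 1] by (simp add: h_def)
  have "\<omega> \<noteq> 0" "\<omega> \<noteq> 1" using irr by auto
  moreover have "\<omega> \<ge> 0" using lower[of 1] by (metis mult_1 of_nat_0_le_iff of_nat_1 order_trans)
  moreover have "\<omega> \<le> 1"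
  proof (rule ccontr)
    assume "\<not> \<omega> \<le> 1"
    then obtain n where n: "1 < real n * (\<omega> - 1)" using reals_Archimedean3[of "\<omega> - 1"] by auto
    have "real (h n) \<le> real n" using weight_le[OF u, of 1 n] by (simp add: h_def)
    with upper[of n] n show False by (simp add: algebra_simps)
  qed
  moreover have "int (u k) = \<lfloor>real k * \<omega>\<rfloor> - \<lfloor>(real k - 1) * \<omega>\<rfloor>" if "k \<ge> 1" for k
    using floor_h[of k] floor_h[of "k - 1"] h_Suc[of "k - 1"] that by simp
  ultimately have "\<forall>k\<ge>1. int (u k) = \<lfloor>real k * \<omega>\<rfloor> - \<lfloor>(real k - 1) * \<omega>\<rfloor>" "\<omega> \<in> {0<..<1}"
    by (blast, simp only: greaterThanLessThan_iff, linarith)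
  then show ?thesis using irr by blast
qed

section \<open>Mechanical words\<close>

context
  fixes u :: "nat \<Rightarrow> nat" and \<omega> :: real
  assumes mech: "\<And>k. k \<ge> 1 \<Longrightarrow> int (u k) = \<lfloor>real k * \<omega>\<rfloor> - \<lfloor>(real k - 1) * \<omega>\<rfloor>"
begin

lemma weight_mechanical: "int (weight u (Suc i) n) = \<lfloor>real (i + n) * \<omega>\<rfloor> - \<lfloor>real i * \<omega>\<rfloor>"
proof (induction n)
  case (Suc n)
  show ?case using Suc mech[of "Suc (i + n)"] by (simp add: weight_Suc)
qed simp

text \<open>In this form the position \<open>i\<close> enters only through its rotation point
  \<open>frac (real i * \<omega>)\<close>.\<close>

lemma weight_mechanical_frac: "int (weight u (Suc i) n) = \<lfloor>frac (real i * \<omega>) + real n * \<omega>\<rfloor>"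
proof -
  have "frac (real i * \<omega>) + real n * \<omega> = real (i + n) * \<omega> - of_int \<lfloor>real i * \<omega>\<rfloor>"
    by (simp add: frac_def algebra_simps)
  then show ?thesis by (simp only: weight_mechanical floor_diff_of_int)
qed

text \<open>Over many periods the weight follows the slope up to a bounded error, so a period of
  length \<open>p\<close> and weight \<open>C\<close> forces the slope \<open>C / p\<close>.\<close>

lemma not_eventually_periodic_mechanical:
  assumes irr: "\<omega> \<notin> \<rat>" shows "\<not> eventually_periodic u"
proof
  assume "eventually_periodic u"
  then obtain N p where N: "N \<ge> 1" "p > 0" and per: "\<And>k. k \<ge> N \<Longrightarrow> u (k + p) = u k"
    by (auto simp: eventually_periodic_def)
  obtain M where M: "N = Suc M" using N by (cases N) auto
  define C where "C = weight u N p"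
  have shift: "u (N + j * p + t) = u (N + t)" for j t
  proof (induction j)
    case (Suc j)
    then show ?case using per[of "N + j * p + t"] by (simp add: algebra_simps)
  qed simp
  have wj: "weight u N (j * p) = j * C" for j
  proof (induction j)
    case (Suc j)
    have "weight u (N + j * p) p = C" unfolding C_def by (intro weight_cong) (simp add: shift)
    then show ?case using weight_add[of u N "j * p" p] Suc by (simp add: add.commute)
  qed simp
  have bound: "\<bar>real j * (real p * \<omega> - real C)\<bar> \<le> 2" for j
  proof -
    have "real j * real C = of_int (int (weight u (Suc M) (j * p)))" by (simp add: wj M[symmetric])
    also have "\<dots> = of_int \<lfloor>real (M + j * p) * \<omega>\<rfloor> - of_int \<lfloor>real M * \<omega>\<rfloor>"
      by (simp only: weight_mechanical of_int_diff)
    finally have "real j * real C = of_int \<lfloor>real (M + j * p) * \<omega>\<rfloor> - of_int \<lfloor>real M * \<omega>\<rfloor>" .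
    moreover have "real (M + j * p) * \<omega> = real M * \<omega> + real j * (real p * \<omega>)"
      by (simp add: algebra_simps)
    ultimately show ?thesis
      using floor_correct[of "real (M + j * p) * \<omega>"] floor_correct[of "real M * \<omega>"]
      by (simp only: right_diff_distrib) linarith
  qed
  have "real p * \<omega> - real C = 0"
  proof (rule ccontr)
    assume "real p * \<omega> - real C \<noteq> 0"
    then obtain j where "2 < real j * \<bar>real p * \<omega> - real C\<bar>"
      using reals_Archimedean3[of "\<bar>real p * \<omega> - real C\<bar>"] by auto
    with bound[of j] show False by (simp add: abs_mult)
  qed
  then have "\<omega> = real C / real p" using N by (simp add: field_simps)
  then show False using irr by simp
qed

text \<open>The factor at position \<open>i + 1\<close> is determined by the numbers \<open>\<lfloor>x + j\<omega>\<rfloor>\<close>, \<open>j \<le> n\<close>, with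
  \<open>x = frac (i\<omega>)\<close>. They are monotone in \<open>x\<close>, so their sum, which takes at most \<open>n + 1\<close> values,
  already determines them.\<close>

lemma card_subwords_mechanical_le: "card (subwords u n) \<le> n + 1"
proof -
  define x where "x i = frac (real i * \<omega>)" for i :: nat
  define v where "v i = (\<Sum>j\<in>{1..n}. \<lfloor>x i + real j * \<omega>\<rfloor>)" for i
  define B where "B = (\<Sum>j\<in>{1..n}. \<lfloor>real j * \<omega>\<rfloor>)"
  have x: "0 \<le> x i" "x i < 1" for i by (auto simp: x_def frac_lt_1)
  have inj_le: "factor u (Suc i) n = factor u (Suc k) n" if eq: "v i = v k" and le: "x i \<le> x k" for i k
  proof -
    have "\<lfloor>x i + real j * \<omega>\<rfloor> = \<lfloor>x k + real j * \<omega>\<rfloor>" if "j \<in> {1..n}" for j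
      by (rule sum_mono_inv[OF eq[unfolded v_def] _ that]) (use le in \<open>auto intro: floor_mono\<close>)
    then have w: "weight u (Suc i) j = weight u (Suc k) j" if "j \<le> n" for j
      using that weight_mechanical_frac[of i j] weight_mechanical_frac[of k j]
      by (cases "j = 0") (auto simp: x_def)
    have "u (Suc i + j) = u (Suc k + j)" if "j < n" for j
      using w[of j] w[of "Suc j"] that by (simp add: weight_Suc)
    then show ?thesis by (simp add: factor_eq_iff)
  qed
  then have inj: "factor u (Suc i) n = factor u (Suc k) n" if "v i = v k" for i k
    using that by (metis linear)
  \<comment> \<open>Adding \<open>x i < 1\<close> raises each of the \<open>n\<close> floors by 0 or
    1.\<close>
  have range: "v i \<in> {B..B + int n}" for i
  proof -
    have "\<lfloor>real j * \<omega>\<rfloor> \<le> \<lfloor>x i + real j * \<omega>\<rfloor>" "\<lfloor>x i + real j * \<omega>\<rfloor> \<le> \<lfloor>real j * \<omega>\<rfloor> + 1" for j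
      using x[of i] by linarith+
    then have "B \<le> v i" "v i \<le> (\<Sum>j\<in>{1..n}. \<lfloor>real j * \<omega>\<rfloor> + 1)"
      unfolding B_def v_def by (intro sum_mono; simp)+
    then show ?thesis by (simp add: sum.distrib B_def)
  qed
  have "subwords u n \<subseteq> (\<lambda>z. factor u (Suc (SOME i. v i = z)) n) ` {B..B + int n}"
  proof
    fix y assume "y \<in> subwords u n"
    then obtain i where "i \<ge> 1" "y = factor u i n" by (auto simp: subwords_eq)
    then obtain i where y: "y = factor u (Suc i) n" by (cases i) auto
    have "v (SOME k. v k = v i) = v i" by (rule someI) simp
    then have "y = factor u (Suc (SOME k. v k = v i)) n" using y inj by metis
    then show "y \<in> (\<lambda>z. factor u (Suc (SOME i. v i = z)) n) ` {B..B + int n}"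
      using range[of i] by blast
  qed
  then have "card (subwords u n) \<le> card {B..B + int n}" by (rule surj_card_le[rotated]) simp
  then show ?thesis by simp
qed

text \<open>The complexity is at most \<open>n + 1\<close> by the rotation argument. It is at least
  that because it grows at every length: without right special factors, a repetition would make the
  word eventually periodic.\<close>

lemma sturmian_mechanical:
  assumes irr: "\<omega> \<notin> \<rat>" and \<omega>: "\<omega> \<in> {0<..<1}"
  shows "sturmian u"
proof -
  have "u k \<in> {0, 1}" if "k \<ge> 1" for k
  proof -
    have "real k * \<omega> = (real k - 1) * \<omega> + \<omega>" by (simp add: algebra_simps)
    then have "0 \<le> int (u k)" "int (u k) \<le> 1" using mech[OF that] \<omega> by simp_all linarith
    then show ?thesis by auto
  qed
  then have u: "binary_word u" by (simp add: binary_word_def)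
  have rs: "right_special u n \<noteq> {}" for n
  proof
    assume empty: "right_special u n = {}"
    have "\<not> inj_on (\<lambda>i. factor u i n) {1..}"
      using finite_subwords[OF u, of n] finite_imageD[of "\<lambda>i. factor u i n" "{1..}"]
      by (auto simp: subwords_eq infinite_Ici)
    then obtain r s where "1 \<le> r" "r < s" "factor u r n = factor u s n"
      by (auto simp: inj_on_def) (metis linorder_neqE_nat)
    then have "eventually_periodic u"
      using eventually_periodic_if_repetition[OF u] empty by blast
    with not_eventually_periodic_mechanical[OF irr] show False by simp
  qed
  have "card (subwords u n) \<ge> n + 1" for n
  proof (induction n)
    case (Suc n)
    have "right_special u n \<subseteq> subwords u n" by (auto simp: right_special_def subwords_eq factor_Suc)
    then have "finite (right_special u n)" using finite_subwords[OF u] finite_subset by blast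
    then have "card (right_special u n) > 0" using rs by (simp add: card_gt_0_iff)
    then show ?case using Suc card_subwords_Suc[OF u, of n] by simp
  qed simp
  then show ?thesis
    using card_subwords_mechanical_le u by (auto simp: sturmian_def binary_word_def intro: antisym)
qed

end

text \<open>The word determines the floor of every multiple of its slope, while multiples of
  different slopes drift apart by more than 1.\<close>

lemma mechanical_slope_unique:
  assumes "\<And>k. k \<ge> 1 \<Longrightarrow> int (u k) = \<lfloor>real k * \<omega>\<rfloor> - \<lfloor>(real k - 1) * \<omega>\<rfloor>"
    and "\<And>k. k \<ge> 1 \<Longrightarrow> int (u k) = \<lfloor>real k * \<omega>'\<rfloor> - \<lfloor>(real k - 1) * \<omega>'\<rfloor>"
  shows "\<omega> = \<omega>'"
proof (rule ccontr)
  assume "\<omega> \<noteq> \<omega>'"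
  then obtain n where n: "1 < real n * \<bar>\<omega> - \<omega>'\<bar>" using reals_Archimedean3[of "\<bar>\<omega> - \<omega>'\<bar>"] by auto
  have "\<lfloor>real n * \<omega>\<rfloor> = \<lfloor>real n * \<omega>'\<rfloor>"
    using weight_mechanical[OF assms(1), of 0 n] weight_mechanical[OF assms(2), of 0 n] by simp
  then have "\<bar>real n * \<omega> - real n * \<omega>'\<bar> < 1" by linarith
  also have "real n * \<omega> - real n * \<omega>' = real n * (\<omega> - \<omega>')" by (simp add: algebra_simps)
  finally show False using n by (simp add: abs_mult)
qed

section \<open>Cutting times\<close>

context
  fixes a b c :: real and f :: "real \<Rightarrow> real"
  assumes unimodal: "unimodal_map a b f c"
    and c2_less: "f (f c) < c" and c_less: "c < f c"
begin

section \<open>Monotone branches of the unimodal map\<close>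

lemma unimodal_continuous: "continuous_on {a..b} f" and unimodal_maps_to: "x \<in> {a..b} \<Longrightarrow> f x \<in> {a..b}"
  and turning_point_interior: "a < c" "c < b"
  using unimodal unfolding unimodal_map_def by (blast, blast, simp_all)

lemma unimodal_incr: "a \<le> x \<Longrightarrow> x \<le> y \<Longrightarrow> y \<le> c \<Longrightarrow> f x \<le> f y"
  using unimodal strict_mono_on_leD[of "{a..c}" f x y] by (auto simp: unimodal_map_def)

lemma unimodal_decr: "c \<le> x \<Longrightarrow> x \<le> y \<Longrightarrow> y \<le> b \<Longrightarrow> f y \<le> f x"
  using unimodal
  by (cases "x = y") (auto simp: unimodal_map_def monotone_on_def intro: less_imp_le)

lemma orbit_in: "x \<in> {a..b} \<Longrightarrow> (f ^^ n) x \<in> {a..b}"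
  by (induction n) (auto simp: unimodal_maps_to simp del: atLeastAtMost_iff)

lemma c_orbit_in: "(f ^^ n) c \<in> {a..b}"
  by (rule orbit_in) (use turning_point_interior in auto)

lemma unimodal_le_max: "x \<in> {a..b} \<Longrightarrow> f x \<le> f c"
  using unimodal_incr[of x c] unimodal_decr[of c x] by (cases "x \<le> c") auto

lemma segment_subset_interval: "x \<in> {a..b} \<Longrightarrow> y \<in> {a..b} \<Longrightarrow> closed_segment x y \<subseteq> {a..b}"
  by (auto simp: closed_segment_eq_real_ivl split: if_splits)

lemma image_segment:
  assumes x: "x \<in> {a..b}" "y \<in> {a..b}" and side: "{x, y} \<subseteq> {a..c} \<or> {x, y} \<subseteq> {c..b}"
  shows "f ` closed_segment x y = closed_segment (f x) (f y)"
proof -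
  have *: "f ` closed_segment s t = closed_segment (f s) (f t)"
    if st: "s \<le> t" "a \<le> s" "t \<le> b" "t \<le> c \<or> c \<le> s" for s t
  proof -
    have cont': "continuous_on {s..t} f" using st by (intro continuous_on_subset[OF unimodal_continuous]) auto
    show ?thesis
    proof (cases "t \<le> c")
      case True
      then have bounds: "f s \<le> f t" "\<And>z. z \<in> {s..t} \<Longrightarrow> f z \<in> {f s..f t}"
        using st by (auto intro!: unimodal_incr)
      have "v \<in> f ` {s..t}" if v: "v \<in> {f s..f t}" for v
      proof -
        obtain z where "s \<le> z" "z \<le> t" "f z = v" using IVT'[of f s v t] v st(1) cont' by auto
        then show ?thesis by auto
      qed
      with bounds(2) have "f ` {s..t} = {f s..f t}" by blast
      then show ?thesis using bounds(1) st(1) by (simp add: closed_segment_eq_real_ivl1)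
    next
      case False
      then have bounds: "f t \<le> f s" "\<And>z. z \<in> {s..t} \<Longrightarrow> f z \<in> {f t..f s}"
        using st by (auto intro!: unimodal_decr)
      have "v \<in> f ` {s..t}" if v: "v \<in> {f t..f s}" for v
      proof -
        obtain z where "s \<le> z" "z \<le> t" "f z = v" using IVT2'[of f t v s] v st(1) cont' by auto
        then show ?thesis by auto
      qed
      with bounds(2) have "f ` {s..t} = {f t..f s}" by blast
      then show ?thesis
        using bounds(1) st(1) by (simp add: closed_segment_eq_real_ivl1 closed_segment_commute[of "f s"])
    qed
  qed
  show ?thesis
  proof (cases "x \<le> y")
    case True
    then show ?thesis using *[of x y] assms by auto
  next
    case False
    then show ?thesis using *[of y x] assms
      by (auto simp: closed_segment_commute[of x] closed_segment_commute[of "f x"])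
  qed
qed

lemma image_segment_c: "x \<in> {a..b} \<Longrightarrow> f ` closed_segment x c = closed_segment (f x) (f c)"
  using turning_point_interior by (intro image_segment) auto

section \<open>Cutting intervals and differences of cutting times\<close>

lemma one_cutting: "1 \<in> cutting_times f c"
  by (simp add: cutting_times_def)

lemma two_cutting: "2 \<in> cutting_times f c"
  using c2_less c_less
  by (simp add: cutting_times_def numeral_2_eq_2 closed_segment_eq_real_ivl)

lemma cutting_interval_after:
  assumes "n \<in> cutting_times f c"
  shows "cutting_interval f c (Suc n) = closed_segment ((f ^^ Suc n) c) (f c)"
  using assms by (cases n) (auto simp: cutting_times_def)

lemma cutting_interval_not:
  assumes "n \<ge> 1" "n \<notin> cutting_times f c"
  shows "cutting_interval f c (Suc n) = f ` cutting_interval f c n"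
  using assms by (cases n) (auto simp: cutting_times_def)

text \<open>A segment avoiding \<open>c\<close> lies on one side of it, so \<open>f\<close> maps
  endpoints to endpoints; after a cut the interval starts afresh at the next orbit point.\<close>

lemma cutting_interval_endpoint:
  "\<exists>d\<in>{a..b}. cutting_interval f c (Suc n) = closed_segment ((f ^^ Suc n) c) d"
proof (induction n)
  case 0
  then show ?case using turning_point_interior closed_segment_commute by (intro bexI[of _ c]) auto
next
  case (Suc n)
  show ?case
  proof (cases "Suc n \<in> cutting_times f c")
    case True
    then show ?thesis
      using cutting_interval_after[OF True] c_orbit_in[of 1] by (intro bexI[of _ "f c"]) auto
  next
    case False
    obtain d where d: "d \<in> {a..b}" "cutting_interval f c (Suc n) = closed_segment ((f ^^ Suc n) c) d"
      using Suc by blast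
    have "c \<notin> closed_segment ((f ^^ Suc n) c) d"
      using False d by (simp add: cutting_times_def)
    then have "f ` closed_segment ((f ^^ Suc n) c) d = closed_segment (f ((f ^^ Suc n) c)) (f d)"
      using d c_orbit_in[of "Suc n"]
      by (intro image_segment) (auto simp: closed_segment_eq_real_ivl split: if_splits)
    then show ?thesis
      using cutting_interval_not[OF _ False] d unimodal_maps_to by auto
  qed
qed

text \<open>The image under \<open>f ^^ j\<close> of the segment between \<open>y\<close> and \<open>c\<close> is connected and contains
  \<open>(f ^^ j) c\<close>, so as long as it avoids \<open>c\<close> it stays in the part of the cutting interval
  that survives the next cut.\<close>

lemma cutting_time_if_preimage:
  assumes m: "m \<ge> 1" and y: "y \<in> {a..b}" and fy: "(f ^^ m) y = c"
    and avoid: "\<And>j. 1 \<le> j \<Longrightarrow> j < m \<Longrightarrow> c \<notin> (f ^^ j) ` closed_segment y c"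
  shows "m \<in> cutting_times f c"
proof (cases "m = 1")
  case True
  then show ?thesis using one_cutting by simp
next
  case False
  define E where "E j = (f ^^ j) ` closed_segment y c" for j
  have seg: "closed_segment y c \<subseteq> {a..b}" using y turning_point_interior by (intro segment_subset_interval) auto
  have E_sub: "E j \<subseteq> {a..b}" for j using orbit_in seg by (auto simp: E_def simp del: atLeastAtMost_iff)
  have E_Suc: "E (Suc j) = f ` E j" for j by (auto simp: E_def)
  have E_conn: "connected (E j)" for j
  proof (induction j)
    case (Suc j)
    then show ?case unfolding E_Suc
      by (intro connected_continuous_image continuous_on_subset[OF unimodal_continuous E_sub])
  qed (simp add: E_def)
  have cE: "(f ^^ j) c \<in> E j" for j by (simp add: E_def)
  have side: "E j \<subseteq> {..<c} \<or> E j \<subseteq> {c<..}" if "1 \<le> j" "j < m" for j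
  proof (rule ccontr)
    assume "\<not> ?thesis"
    then obtain s t where "s \<in> E j" "t \<in> E j" "s \<le> c" "c \<le> t" by (auto simp: not_less subset_iff)
    then have "c \<in> E j" using connectedD_interval[OF E_conn] by blast
    then show False using avoid[OF that] by (simp add: E_def)
  qed
  have "E j \<subseteq> cutting_interval f c j" if "1 \<le> j" "j \<le> m" for j
    using that
  proof (induction j rule: dec_induct)
    case base
    have "E 1 \<subseteq> {c<..}" using side[of 1] cE[of 1] c_less False m by auto
    moreover have "E 1 \<subseteq> {..f c}" using seg unimodal_le_max by (auto simp: E_def)
    ultimately have "E 1 \<subseteq> {c..f c}" by fastforce
    then show ?case using c_less by (simp add: closed_segment_eq_real_ivl)
  next
    case (step j)
    then have IH: "E j \<subseteq> cutting_interval f c j" by simp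
    show ?case
    proof (cases "j \<in> cutting_times f c")
      case False
      then show ?thesis using cutting_interval_not[of j] step IH E_Suc by auto
    next
      case True
      obtain d where d: "cutting_interval f c j = closed_segment ((f ^^ j) c) d"
        using cutting_interval_endpoint[of "j - 1"] step by auto
      have "c \<in> closed_segment ((f ^^ j) c) d" using True d by (simp add: cutting_times_def)
      then have "E j \<subseteq> closed_segment ((f ^^ j) c) c"
        using side[of j] step IH cE[of j] unfolding d
        by (fastforce simp: closed_segment_eq_real_ivl split: if_splits)
      then have "E (Suc j) \<subseteq> f ` closed_segment ((f ^^ j) c) c" unfolding E_Suc by blast
      then show ?thesis
        using image_segment_c[OF c_orbit_in[of j]] cutting_interval_after[OF True] by simp
    qed
  qed
  moreover have "c \<in> E m" using fy by (auto simp: E_def)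
  ultimately show ?thesis using m by (auto simp: cutting_times_def)
qed

text \<open>From the cut at \<open>n\<close> to the next one, the intervals are the images of the
  segment between \<open>(f ^^ n) c\<close> and \<open>c\<close>. The next cut provides a point
  \<open>y\<close> of this segment with \<open>(f ^^ m) y = c\<close>, and earlier images of the
  shorter segment from \<open>y\<close> to \<open>c\<close> miss \<open>c\<close>.\<close>

lemma cutting_time_diff:
  assumes n: "n \<in> cutting_times f c" and nm: "n + m \<in> cutting_times f c" and m: "m \<ge> 1"
    and between: "\<And>j. 1 \<le> j \<Longrightarrow> j < m \<Longrightarrow> n + j \<notin> cutting_times f c"
  shows "m \<in> cutting_times f c"
proof -
  have img: "cutting_interval f c (n + j) = (f ^^ j) ` closed_segment ((f ^^ n) c) c"
    if "1 \<le> j" "j \<le> m" for j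
    using that
  proof (induction j rule: dec_induct)
    case base
    show ?case using cutting_interval_after[OF n] image_segment_c[OF c_orbit_in[of n]] by simp
  next
    case (step j)
    then show ?case
      using cutting_interval_not[of "n + j"] between[of j] by (simp add: image_comp)
  qed
  obtain y where y: "y \<in> closed_segment ((f ^^ n) c) c" "(f ^^ m) y = c"
    using nm img[of m] m by (auto simp: cutting_times_def)
  have sub: "closed_segment y c \<subseteq> closed_segment ((f ^^ n) c) c"
    using y by (simp add: subset_closed_segment)
  show ?thesis
  proof (rule cutting_time_if_preimage[OF m _ y(2)])
    show "y \<in> {a..b}" using y segment_subset_interval[OF c_orbit_in[of n], of c] turning_point_interior by auto
    show "c \<notin> (f ^^ j) ` closed_segment y c" if "1 \<le> j" "j < m" for j
      using img[of j] between[OF that] that n sub by (auto simp: cutting_times_def)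
  qed
qed

section \<open>The kneading map and the order of the orbit\<close>

context
  assumes inf: "infinite (cutting_times f c)" and c2_c3: "f (f c) < f (f (f c))"
begin

lemma cutting_time_in: "cutting_time f c k \<in> cutting_times f c"
  unfolding cutting_time_def by (rule enumerate_in_set[OF inf])

lemma cutting_time_less_iff: "cutting_time f c j < cutting_time f c k \<longleftrightarrow> j < k"
  unfolding cutting_time_def using enumerate_mono_iff[OF inf] by simp

lemma cutting_time_gap:
  "cutting_time f c k < n \<Longrightarrow> n < cutting_time f c (Suc k) \<Longrightarrow> n \<notin> cutting_times f c"
  unfolding cutting_time_def using enumerate_Suc''[OF inf] not_less_Least by (metis (mono_tags, lifting))

lemma cutting_time_0: "cutting_time f c 0 = 1"
  unfolding cutting_time_def enumerate_0
  by (rule Least_equality) (use one_cutting in \<open>auto simp: cutting_times_def\<close>)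

lemma cutting_time_1: "cutting_time f c 1 = 2"
proof -
  have "cutting_time f c 1 = (LEAST s. s \<in> cutting_times f c \<and> cutting_time f c 0 < s)"
    unfolding cutting_time_def using enumerate_Suc''[OF inf, of 0] by simp
  also have "\<dots> = 2" by (rule Least_equality) (use two_cutting cutting_time_0 in auto)
  finally show ?thesis .
qed

text \<open>This resolves the definite description: the difference is a cutting time by
  \<open>cutting_time_diff\<close>, and its index is unique since cutting times increase
  strictly.\<close>

lemma cutting_time_Suc:
  "cutting_time f c (Suc k) = cutting_time f c k + cutting_time f c (kneading_map f c (Suc k))"
proof -
  define m where "m = cutting_time f c (Suc k) - cutting_time f c k"
  have eq: "cutting_time f c k + m = cutting_time f c (Suc k)" and m: "m \<ge> 1"
    using cutting_time_less_iff[of k "Suc k"] by (auto simp: m_def)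
  have "m \<in> cutting_times f c"
    by (rule cutting_time_diff[OF cutting_time_in[of k]])
      (use eq m cutting_time_in[of "Suc k"] cutting_time_gap[of k] in auto)
  then obtain j where j: "cutting_time f c j = m"
    using enumerate_Ex[of "cutting_times f c" m] inf unfolding cutting_time_def by blast
  have "kneading_map f c (Suc k) = (THE j. m = cutting_time f c j)"
    by (simp add: kneading_map_def m_def)
  also have "\<dots> = j"
    using j cutting_time_less_iff by (intro the_equality) (metis less_irrefl linorder_neqE_nat)+
  finally show ?thesis using j eq by simp
qed

text \<open>The interval from \<open>c_2\<close> to \<open>c_1\<close> is invariant: on it
  \<open>f\<close> is smallest at an endpoint, where its values are \<open>c_3 > c_2\<close> and
  \<open>c_2\<close>.\<close>

lemma c2_le_orbit: "f (f c) \<le> (f ^^ Suc n) c"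
proof (induction n)
  case 0
  then show ?case using c2_less c_less by simp
next
  case (Suc n)
  define x where "x = (f ^^ Suc n) c"
  have x: "x \<in> {a..b}" "f (f c) \<le> x" using Suc c_orbit_in[of "Suc n"] by (simp_all add: x_def)
  have "x \<le> f c" using unimodal_le_max[OF c_orbit_in[of n]] by (simp add: x_def)
  moreover have "f (f c) \<in> {a..b}" "f c \<in> {a..b}" using c_orbit_in[of 1] c_orbit_in[of 2]
    by (simp_all add: numeral_2_eq_2)
  ultimately have "f (f c) \<le> f x"
    using unimodal_incr[of "f (f c)" x] unimodal_decr[of x "f c"] c2_c3 x by (cases "x \<le> c") auto
  then show ?case by (simp add: x_def)
qed

text \<open>The next interval is already cut; its endpoint \<open>f c\<close> is right of
  \<open>c\<close>, so the other one is not.\<close>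

lemma kneading_0:
  assumes "kneading_map f c (Suc k) = 0"
  shows "cutting_time f c (Suc k) = Suc (cutting_time f c k)"
    and "(f ^^ Suc (cutting_time f c k)) c \<le> c"
proof -
  show S: "cutting_time f c (Suc k) = Suc (cutting_time f c k)"
    using cutting_time_Suc[of k] assms cutting_time_0 by simp
  have "c \<in> cutting_interval f c (Suc (cutting_time f c k))"
    using cutting_time_in[of "Suc k"] S by (simp add: cutting_times_def)
  then show "(f ^^ Suc (cutting_time f c k)) c \<le> c"
    using cutting_interval_after[OF cutting_time_in[of k]] c_less
    by (auto simp: closed_segment_eq_real_ivl split: if_splits)
qed

text \<open>The first interval after the cut misses \<open>c\<close>, so it lies right of
  \<open>c\<close> and \<open>f\<close> decreases on it. Its image contains \<open>c\<close>, and
  the largest value there is taken at the left endpoint, the orbit point.\<close>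

lemma kneading_1:
  assumes "kneading_map f c (Suc k) = 1"
  shows "cutting_time f c (Suc k) = Suc (Suc (cutting_time f c k))"
    and "c < (f ^^ Suc (cutting_time f c k)) c" "c \<le> (f ^^ Suc (Suc (cutting_time f c k))) c"
proof -
  define n where "n = cutting_time f c k"
  define x where "x = (f ^^ Suc n) c"
  have D: "cutting_interval f c (Suc n) = closed_segment x (f c)"
    using cutting_interval_after[OF cutting_time_in[of k]] by (simp add: x_def n_def)
  show S: "cutting_time f c (Suc k) = Suc (Suc (cutting_time f c k))"
    using cutting_time_Suc[of k] assms cutting_time_1 by simp
  then have not: "Suc n \<notin> cutting_times f c" using cutting_time_gap[of k "Suc n"] by (simp add: n_def)
  then have "c \<notin> closed_segment x (f c)" using D by (simp add: cutting_times_def)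
  then have cx: "c < x" using c_less by (auto simp: closed_segment_eq_real_ivl split: if_splits)
  then show "c < (f ^^ Suc (cutting_time f c k)) c" by (simp add: x_def n_def)
  have xb: "x \<in> {a..b}" "f c \<in> {a..b}" "x \<le> f c"
    using c_orbit_in[of "Suc n"] c_orbit_in[of 1] unimodal_le_max[OF c_orbit_in[of n]] by (simp_all add: x_def)
  have "c \<in> cutting_interval f c (Suc (Suc n))"
    using cutting_time_in[of "Suc k"] S by (simp add: cutting_times_def n_def)
  then have "c \<in> f ` closed_segment x (f c)" using cutting_interval_not[OF _ not] D by simp
  then obtain z where z: "z \<in> {x..f c}" "c = f z" using xb by (auto simp: closed_segment_eq_real_ivl)
  then have "c \<le> f x" using unimodal_decr[of x z] cx xb by auto
  then show "c \<le> (f ^^ Suc (Suc (cutting_time f c k))) c" by (simp add: x_def n_def)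
qed

text \<open>While the letters agree, corresponding orbit points keep their order. A first difference
  with 1 in the prefix and 0 in the shift would place them in the opposite order around
  \<open>c\<close>.\<close>

lemma lex_minimal_kneading_map:
  assumes Q: "\<And>k. k \<ge> 1 \<Longrightarrow> kneading_map f c k \<le> 1"
  shows "lex_minimal (kneading_map f c)"
  unfolding lex_minimal_def
proof (intro allI impI)
  fix k j
  assume eq: "\<forall>i\<in>{1..j}. kneading_map f c (k + i) = kneading_map f c i"
  \<comment> \<open>The letter \<open>Suc i\<close> is read at \<open>z i\<close>; the reading
    starts at \<open>c_2\<close> because the first cutting time is 1.\<close>
  define z where "z i = (f ^^ Suc (cutting_time f c i)) c" for i
  have Q01: "kneading_map f c (Suc i) = 0 \<or> kneading_map f c (Suc i) = 1" for i
    using Q[of "Suc i"] by auto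
  have zI: "z i \<in> {a..b}" "f (z i) \<in> {a..b}" for i
    using c_orbit_in[of "Suc (cutting_time f c i)"] unimodal_maps_to by (auto simp: z_def simp del: atLeastAtMost_iff)
  have z0: "z (Suc i) = f (z i)" "z i \<le> c" if "kneading_map f c (Suc i) = 0" for i
    using kneading_0[OF that] by (simp_all add: z_def)
  have z1: "z (Suc i) = f (f (z i))" "c < z i" "c \<le> f (z i)" if "kneading_map f c (Suc i) = 1" for i
    using kneading_1[OF that] by (simp_all add: z_def)
  have le: "z i \<le> z (k + i)" if "i \<le> j" for i
    using that
  proof (induction i)
    case 0
    then show ?case using c2_le_orbit[of "cutting_time f c k"] cutting_time_0 by (simp add: z_def)
  next
    case (Suc i)
    then have IH: "z i \<le> z (k + i)" by simp
    have e: "kneading_map f c (Suc (k + i)) = kneading_map f c (Suc i)"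
      using eq Suc.prems by (metis Suc_eq_plus1 add_Suc_right atLeastAtMost_iff le_add2)
    show ?case
    proof (cases "kneading_map f c (Suc i) = 0")
      case True
      then show ?thesis using z0[of i] z0[of "k + i"] e IH unimodal_incr[of "z i" "z (k + i)"] zI[of i] by simp
    next
      case False
      then have 1: "kneading_map f c (Suc i) = 1" using Q01[of i] by simp
      \<comment> \<open>Two order-reversing steps restore the order; the letter 1 keeps the
        intermediate points on the decreasing branch too.\<close>
      have "f (z (k + i)) \<le> f (z i)" using IH z1[OF 1] zI[of "k + i"] by (intro unimodal_decr) auto
      then have "f (f (z i)) \<le> f (f (z (k + i)))"
        using z1[of "k + i"] e 1 zI[of i] by (intro unimodal_decr[of "f (z (k + i))" "f (z i)"]) auto
      then show ?thesis using z1[of i] z1[of "k + i"] e 1 by simp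
    qed
  qed
  show "kneading_map f c (Suc j) \<le> kneading_map f c (k + Suc j)"
  proof (rule ccontr)
    assume "\<not> ?thesis"
    then have "kneading_map f c (Suc j) = 1" "kneading_map f c (Suc (k + j)) = 0"
      using Q01[of j] Q01[of "k + j"] by auto
    then have "c < z j" "z (k + j) \<le> c" using z0(2) z1(2) by blast+
    with le[of j] show False by simp
  qed
qed

lemma cutting_time_eq_sum:
  assumes Q: "\<And>k. k \<ge> 1 \<Longrightarrow> kneading_map f c k \<le> 1"
  shows "cutting_time f c k = 1 + k + weight (kneading_map f c) 1 k"
proof (induction k)
  case 0
  then show ?case by (simp add: cutting_time_0)
next
  case (Suc k)
  have "kneading_map f c (Suc k) = 0 \<or> kneading_map f c (Suc k) = 1" using Q[of "Suc k"] by auto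
  then show ?case using Suc kneading_0(1)[of k] kneading_1(1)[of k] by (auto simp: weight_Suc)
qed

end

end

theorem theorem1p1:
  fixes a b c :: real and f :: "real \<Rightarrow> real" and Q :: "nat \<Rightarrow> nat"
  assumes unimodal: "unimodal_map a b f c"
    and norm1: "(f ^^ 2) c < c" "c < f c"
    and norm2: "(f ^^ 2) c < (f ^^ 3) c"
    and inf: "infinite (cutting_times f c)"
    and Q_def: "Q = kneading_map f c"
    and Q_le: "\<forall>k\<ge>1. Q k \<le> 1"
  shows "(sturmian Q \<longleftrightarrow>
           (\<exists>!\<omega>::real. \<omega> \<notin> \<rat> \<and> \<omega> \<in> {0<..<1} \<and>
              (\<forall>k\<ge>1. int (Q k) = \<lfloor>real k * \<omega>\<rfloor> - \<lfloor>(real k - 1) * \<omega>\<rfloor>)))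
       \<and> (\<forall>\<omega>::real. \<omega> \<notin> \<rat> \<and> \<omega> \<in> {0<..<1} \<and>
              (\<forall>k\<ge>1. int (Q k) = \<lfloor>real k * \<omega>\<rfloor> - \<lfloor>(real k - 1) * \<omega>\<rfloor>) \<longrightarrow>
            (\<forall>k\<ge>1. int (Q k) = lower_mechanical_word \<omega> k) \<and>
            (\<forall>k. int (cutting_time f c k) = 1 + int k + \<lfloor>real k * \<omega>\<rfloor> \<and>
                 1 + int k + \<lfloor>real k * \<omega>\<rfloor> = 1 + \<lfloor>real k * (1 + \<omega>)\<rfloor>))"
proof -
  have c2: "f (f c) < c" and c23: "f (f c) < f (f (f c))"
    using norm1 norm2 by (simp_all add: numeral_2_eq_2 numeral_3_eq_3)
  have Q1: "\<And>k. k \<ge> 1 \<Longrightarrow> kneading_map f c k \<le> 1" using Q_le Q_def by simp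
  \<comment> \<open>The dynamics enters through two facts: minimality of the word, and cutting times
    as prefix weights.\<close>
  have lex: "lex_minimal Q"
    unfolding Q_def by (rule lex_minimal_kneading_map[OF unimodal c2 norm1(2) inf c23 Q1])
  have sum: "cutting_time f c k = 1 + k + weight Q 1 k" for k
    unfolding Q_def by (rule cutting_time_eq_sum[OF unimodal c2 norm1(2) inf c23 Q1])
  have "sturmian Q \<longleftrightarrow>
           (\<exists>!\<omega>::real. \<omega> \<notin> \<rat> \<and> \<omega> \<in> {0<..<1} \<and>
              (\<forall>k\<ge>1. int (Q k) = \<lfloor>real k * \<omega>\<rfloor> - \<lfloor>(real k - 1) * \<omega>\<rfloor>))"
  proof
    assume "sturmian Q"
    then show "\<exists>!\<omega>::real. \<omega> \<notin> \<rat> \<and> \<omega> \<in> {0<..<1} \<and>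
              (\<forall>k\<ge>1. int (Q k) = \<lfloor>real k * \<omega>\<rfloor> - \<lfloor>(real k - 1) * \<omega>\<rfloor>)"
      by (rule ex_ex1I[OF lower_mechanical_if_sturmian[OF _ lex]])
        (blast intro: mechanical_slope_unique)
  qed (blast intro: sturmian_mechanical)
  \<comment> \<open>The prefix weight telescopes to the floor of
    \<open>real k * \<omega>\<close>.\<close>
  moreover have "int (cutting_time f c k) = 1 + int k + \<lfloor>real k * \<omega>\<rfloor>"
    if "\<And>k. k \<ge> 1 \<Longrightarrow> int (Q k) = \<lfloor>real k * \<omega>\<rfloor> - \<lfloor>(real k - 1) * \<omega>\<rfloor>" for \<omega> :: real and k
    using weight_mechanical[OF that, of 0 k] by (simp add: sum)
  moreover have "int k + \<lfloor>real k * \<omega>\<rfloor> = \<lfloor>real k * (1 + \<omega>)\<rfloor>" for \<omega> :: real and k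
    by (simp add: distrib_left)
  ultimately show ?thesis
    by (simp add: lower_mechanical_word_def)
qed

end
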